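(* Let $I$ be a set, let $(\mathbb{C},p:\dot{\mathcal{U}}\to\mathcal{U})$ be a natural model and let $\{O_i\mid i\in I\}\subseteq\mathcal{U}(\diamond)$ be an $I$-indexed family. There is a unique morphism of natural models $F:(\mathbb{C}_I,p_I)\to(\mathbb{C},p)$ such that $F(i)=O_i$ for all $i\in I$. Hence $(\mathbb{C}_I,p_I)$ is initial in the category $\mathbf{NM}_{(\mathsf{ty}_i)_{i\in I}}$ of natural models equipped with an $I$-indexed family of basic types.
   Context: $\mathsf{y}$ is the Yoneda embedding; elements $x\in P(\Gamma)$ of a presheaf are identified with maps $\mathsf{y}(\Gamma)\to P$, and $x[\sigma]=P(\sigma)(x)$. A natural model $(\mathbb{C},p)$ consists of a small category $\mathbb{C}$ with a distinguished terminal object $\diamond$, presheaves $\mathcal{U},\dot{\mathcal{U}}$ on $\mathbb{C}$, a natural transformation $p:\dot{\mathcal{U}}\to\mathcal{U}$ and, for each object $\Gamma$ and $A\in\mathcal{U}(\Gamma)$, a chosen object $\Gamma\cdot A$, morphism $\mathsf{p}_A:\Gamma\cdot A\to\Gamma$ and element $\mathsf{q}_A\in\dot{\mathcal{U}}(\Gamma\cdot A)$ such that the square with top $\mathsf{q}_A$, right $p$, left $\mathsf{y}(\mathsf{p}_A)$, bottom $A$ is a pullback. A morphism of natural models $F:(\mathbb{C},p)\to(\mathbb{D},q:\dot{\mathcal{V}}\to\mathcal{V})$ is a functor $F:\mathbb{C}\to\mathbb{D}$ strictly preserving distinguished terminal objects together with functions $A\mapsto FA:\mathcal{U}(\Gamma)\to\mathcal{V}(F\Gamma)$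 and $a\mapsto Fa:\dot{\mathcal{U}}(\Gamma)\to\dot{\mathcal{V}}(F\Gamma)$, natural in $\Gamma$, with $q(Fa)=F(p(a))$ and strictly preserving the chosen data: $F(\Gamma\cdot A)=F\Gamma\cdot FA$, $F(\mathsf{p}_A)=\mathsf{p}_{FA}$, $F(\mathsf{q}_A)=\mathsf{q}_{FA}$. An $I$-indexed family of basic types in $(\mathbb{C},p)$ is a family of elements $O_i\in\mathcal{U}(\diamond)$; morphisms in $\mathbf{NM}_{(\mathsf{ty}_i)_{i\in I}}$ are morphisms of natural models preserving the families. The natural model $(\mathbb{C}_I,p_I)$: let $\mathbf{Fin}$ be the category of finite sets $n=\{0,\dots,n-1\}$ and functions. $\mathbb{C}_I=(\mathbf{Fin}/I)^{\mathrm{op}}$, so objects are pairs $(A,u)$ with $u:A\to I$ and a morphism $(A,u)\to(B,v)$ in $\mathbb{C}_I$ is a function $B\to A$ over $I$. The terminal object is $(\varnothing,!)$. $\mathcal{U}_I$ is the constant presheaf with value $I$; $\dot{\mathcal{U}}_I(A,u)=A$ with $\dot{\mathcal{U}}_I(f)=f$; $(p_I)_{(A,u)}=u:A\to I$. For $j\in I$: $(A,u)\cdot j=(A+1,[u,j])$ (appending one new last element mapped to $j$), $\mathsf{p}_j:(A,u)\cdot j\to(A,u)$ is the inclusion $A\hookrightarrow A+1$, and $\mathsf{q}_j\in A+1$ is the new element. The distinguished basic types are the elements $i\in I=\mathcal{U}_I(\varnothing,!)$. *)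

theory Defs
  imports "HOL-Library.FuncSet"
begin

section \<open>Small categories and presheaves\<close>

record ('o, 'a) cat_data =
  Obj :: "'o set"
  Arr :: "'a set"
  Src :: "'a \<Rightarrow> 'o"
  Tgt :: "'a \<Rightarrow> 'o"
  Ident :: "'o \<Rightarrow> 'a"
  Comp :: "'a \<Rightarrow> 'a \<Rightarrow> 'a"

text \<open>\<open>Comp C g f\<close> is "g after f"; it is meaningful only if \<open>Src C g = Tgt C f\<close>.\<close>

definition hom :: "('o, 'a) cat_data \<Rightarrow> 'o \<Rightarrow> 'o \<Rightarrow> 'a set" where
  "hom C x y = {f \<in> Arr C. Src C f = x \<and> Tgt C f = y}"

locale category =
  fixes C :: "('o, 'a) cat_data"
  assumes Src_Obj: "f \<in> Arr C \<Longrightarrow> Src C f \<in> Obj C"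
    and Tgt_Obj: "f \<in> Arr C \<Longrightarrow> Tgt C f \<in> Obj C"
    and Ident_hom: "x \<in> Obj C \<Longrightarrow> Ident C x \<in> hom C x x"
    and Comp_hom: "f \<in> hom C x y \<Longrightarrow> g \<in> hom C y z \<Longrightarrow> Comp C g f \<in> hom C x z"
    and Comp_Ident_left: "f \<in> hom C x y \<Longrightarrow> Comp C (Ident C y) f = f"
    and Comp_Ident_right: "f \<in> hom C x y \<Longrightarrow> Comp C f (Ident C x) = f"
    and Comp_assoc: "f \<in> hom C w x \<Longrightarrow> g \<in> hom C x y \<Longrightarrow> h \<in> hom C y z \<Longrightarrow>
      Comp C h (Comp C g f) = Comp C (Comp C h g) f"

definition terminal_object :: "('o, 'a) cat_data \<Rightarrow> 'o \<Rightarrow> bool" where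
  "terminal_object C t \<longleftrightarrow> t \<in> Obj C \<and> (\<forall>x\<in>Obj C. \<exists>!f. f \<in> hom C x t)"

text \<open>\<open>Sec P x\<close> is the set \<open>P(x)\<close>, and \<open>Res P f a\<close> is \<open>a[f]\<close>. The sets \<open>Sec P x\<close> for
  different \<open>x\<close> need not be disjoint.\<close>

record ('o, 'a, 'e) psh_data =
  Sec :: "'o \<Rightarrow> 'e set"
  Res :: "'a \<Rightarrow> 'e \<Rightarrow> 'e"

locale presheaf = category C for C :: "('o, 'a) cat_data" +
  fixes P :: "('o, 'a, 'e) psh_data"
  assumes Res_Sec: "f \<in> hom C x y \<Longrightarrow> a \<in> Sec P y \<Longrightarrow> Res P f a \<in> Sec P x"
    and Res_Ident: "x \<in> Obj C \<Longrightarrow> a \<in> Sec P x \<Longrightarrow> Res P (Ident C x) a = a"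
    and Res_Comp: "f \<in> hom C x y \<Longrightarrow> g \<in> hom C y z \<Longrightarrow> a \<in> Sec P z \<Longrightarrow>
      Res P (Comp C g f) a = Res P f (Res P g a)"

locale nat_trans = dom: presheaf C P + cod: presheaf C Q
  for C :: "('o, 'a) cat_data" and P :: "('o, 'a, 'e) psh_data" and Q :: "('o, 'a, 'f) psh_data" +
  fixes t :: "'o \<Rightarrow> 'e \<Rightarrow> 'f"
  assumes component: "x \<in> Obj C \<Longrightarrow> a \<in> Sec P x \<Longrightarrow> t x a \<in> Sec Q x"
    and naturality: "f \<in> hom C x y \<Longrightarrow> a \<in> Sec P y \<Longrightarrow> t x (Res P f a) = Res Q f (t y a)"

text \<open>The Yoneda embedding on objects and arrows, and the map \<open>y(x) \<rightarrow> P\<close> that corresponds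
  to an element of \<open>P(x)\<close>.\<close>

definition yon :: "('o, 'a) cat_data \<Rightarrow> 'o \<Rightarrow> ('o, 'a, 'a) psh_data" where
  "yon C x = \<lparr>Sec = (\<lambda>w. hom C w x), Res = (\<lambda>f s. Comp C s f)\<rparr>"

definition yon_map :: "('o, 'a) cat_data \<Rightarrow> 'a \<Rightarrow> 'o \<Rightarrow> 'a \<Rightarrow> 'a" where
  "yon_map C f = (\<lambda>w s. Comp C f s)"

definition elem_map :: "('o, 'a, 'e) psh_data \<Rightarrow> 'e \<Rightarrow> 'o \<Rightarrow> 'a \<Rightarrow> 'e" where
  "elem_map P a = (\<lambda>w s. Res P s a)"

definition commuting_square :: "('o, 'a) cat_data \<Rightarrow> ('o, 'a, 't) psh_data \<Rightarrow>
    ('o \<Rightarrow> 't \<Rightarrow> 'x) \<Rightarrow> ('o \<Rightarrow> 't \<Rightarrow> 'y) \<Rightarrow> ('o \<Rightarrow> 'x \<Rightarrow> 'z) \<Rightarrow> ('o \<Rightarrow> 'y \<Rightarrow> 'z) \<Rightarrow> bool" where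
  "commuting_square C T s t f g \<longleftrightarrow>
    (\<forall>w\<in>Obj C. \<forall>c\<in>Sec T w. f w (s w c) = g w (t w c))"

text \<open>\<open>m\<close> is a map \<open>T \<rightarrow> P\<close> with \<open>h \<circ> m = s\<close> and \<open>k \<circ> m = t\<close>.\<close>

definition mediating :: "('o, 'a) cat_data \<Rightarrow> ('o, 'a, 'p) psh_data \<Rightarrow>
    ('o \<Rightarrow> 'p \<Rightarrow> 'x) \<Rightarrow> ('o \<Rightarrow> 'p \<Rightarrow> 'y) \<Rightarrow>
    ('o, 'a, 't) psh_data \<Rightarrow> ('o \<Rightarrow> 't \<Rightarrow> 'x) \<Rightarrow> ('o \<Rightarrow> 't \<Rightarrow> 'y) \<Rightarrow> ('o \<Rightarrow> 't \<Rightarrow> 'p) \<Rightarrow> bool" where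
  "mediating C P h k T s t m \<longleftrightarrow> nat_trans C T P m \<and>
    (\<forall>w\<in>Obj C. \<forall>c\<in>Sec T w. h w (m w c) = s w c \<and> k w (m w c) = t w c)"

text \<open>The square with top \<open>h : P \<rightarrow> X\<close>, left \<open>k : P \<rightarrow> Y\<close>, right \<open>f : X \<rightarrow> Z\<close> and bottom
  \<open>g : Y \<rightarrow> Z\<close> is a pullback of presheaves. A definition cannot quantify over the type in which
  the test presheaf \<open>T\<close> takes its elements. The type \<open>'a\<close> of arrows accommodates the
  representable presheaves and therefore loses nothing: see \<open>pullback_square_universal\<close> below,
  where \<open>T\<close> has an arbitrary type. Uniqueness of the mediating map is up to agreement on the
  carriers.\<close>

definition pullback_square :: "('o, 'a) cat_data \<Rightarrow>
    ('o, 'a, 'p) psh_data \<Rightarrow> ('o, 'a, 'x) psh_data \<Rightarrow> ('o, 'a, 'y) psh_data \<Rightarrow> ('o, 'a, 'z) psh_data \<Rightarrow>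
    ('o \<Rightarrow> 'p \<Rightarrow> 'x) \<Rightarrow> ('o \<Rightarrow> 'p \<Rightarrow> 'y) \<Rightarrow> ('o \<Rightarrow> 'x \<Rightarrow> 'z) \<Rightarrow> ('o \<Rightarrow> 'y \<Rightarrow> 'z) \<Rightarrow> bool" where
  "pullback_square C P X Y Z h k f g \<longleftrightarrow>
    nat_trans C P X h \<and> nat_trans C P Y k \<and> nat_trans C X Z f \<and> nat_trans C Y Z g \<and>
    commuting_square C P h k f g \<and>
    (\<forall>(T :: ('o, 'a, 'a) psh_data) s t.
      nat_trans C T X s \<longrightarrow> nat_trans C T Y t \<longrightarrow> commuting_square C T s t f g \<longrightarrow>
      (\<exists>m. mediating C P h k T s t m) \<and>
      (\<forall>m m'. mediating C P h k T s t m \<longrightarrow> mediating C P h k T s t m' \<longrightarrow>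
        (\<forall>w\<in>Obj C. \<forall>c\<in>Sec T w. m w c = m' w c)))"


section \<open>Natural models\<close>

text \<open>\<open>Ext M x A\<close>, \<open>Pr M x A\<close>, \<open>Qv M x A\<close> are the context extension of \<open>x\<close> by a type
  \<open>A\<close> over \<open>x\<close>, its projection and its generic term.\<close>

record ('o, 'a, 'u, 'e) nm_data =
  Cat :: "('o, 'a) cat_data"
  Term :: 'o
  Ty :: "('o, 'a, 'u) psh_data"
  Tm :: "('o, 'a, 'e) psh_data"
  typ_of :: "'o \<Rightarrow> 'e \<Rightarrow> 'u"
  Ext :: "'o \<Rightarrow> 'u \<Rightarrow> 'o"
  Pr :: "'o \<Rightarrow> 'u \<Rightarrow> 'a"
  Qv :: "'o \<Rightarrow> 'u \<Rightarrow> 'e"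

locale natural_model =
  fixes M :: "('o, 'a, 'u, 'e) nm_data"
  assumes Cat: "category (Cat M)"
    and Term: "terminal_object (Cat M) (Term M)"
    and Ty: "presheaf (Cat M) (Ty M)"
    and Tm: "presheaf (Cat M) (Tm M)"
    and typ_of: "nat_trans (Cat M) (Tm M) (Ty M) (typ_of M)"
    and Ext: "x \<in> Obj (Cat M) \<Longrightarrow> A \<in> Sec (Ty M) x \<Longrightarrow> Ext M x A \<in> Obj (Cat M)"
    and Pr: "x \<in> Obj (Cat M) \<Longrightarrow> A \<in> Sec (Ty M) x \<Longrightarrow> Pr M x A \<in> hom (Cat M) (Ext M x A) x"
    and Qv: "x \<in> Obj (Cat M) \<Longrightarrow> A \<in> Sec (Ty M) x \<Longrightarrow> Qv M x A \<in> Sec (Tm M) (Ext M x A)"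
    and pullback: "x \<in> Obj (Cat M) \<Longrightarrow> A \<in> Sec (Ty M) x \<Longrightarrow>
      pullback_square (Cat M) (yon (Cat M) (Ext M x A)) (Tm M) (yon (Cat M) x) (Ty M)
        (elem_map (Tm M) (Qv M x A)) (yon_map (Cat M) (Pr M x A)) (typ_of M) (elem_map (Ty M) A)"

record ('o, 'a, 'u, 'e, 'o2, 'a2, 'u2, 'e2) nm_map =
  FOb :: "'o \<Rightarrow> 'o2"
  FAr :: "'a \<Rightarrow> 'a2"
  FTy :: "'o \<Rightarrow> 'u \<Rightarrow> 'u2"
  FTm :: "'o \<Rightarrow> 'e \<Rightarrow> 'e2"

text \<open>The four extensionality conditions fix the value \<open>undefined\<close> outside the carriers, so that
  two morphisms are equal in HOL iff they agree on objects, arrows, types and terms of \<open>M\<close>.\<close>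

locale nm_morphism = M: natural_model M + N: natural_model N
  for M :: "('o, 'a, 'u, 'e) nm_data" and N :: "('o2, 'a2, 'u2, 'e2) nm_data" +
  fixes F :: "('o, 'a, 'u, 'e, 'o2, 'a2, 'u2, 'e2) nm_map"
  assumes FOb_ext: "FOb F \<in> extensional (Obj (Cat M))"
    and FAr_ext: "FAr F \<in> extensional (Arr (Cat M))"
    and FTy_ext: "FTy F \<in> extensional (Obj (Cat M))"
      "x \<in> Obj (Cat M) \<Longrightarrow> FTy F x \<in> extensional (Sec (Ty M) x)"
    and FTm_ext: "FTm F \<in> extensional (Obj (Cat M))"
      "x \<in> Obj (Cat M) \<Longrightarrow> FTm F x \<in> extensional (Sec (Tm M) x)"
    and FOb: "x \<in> Obj (Cat M) \<Longrightarrow> FOb F x \<in> Obj (Cat N)"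
    and FAr: "f \<in> hom (Cat M) x y \<Longrightarrow> FAr F f \<in> hom (Cat N) (FOb F x) (FOb F y)"
    and FAr_Ident: "x \<in> Obj (Cat M) \<Longrightarrow> FAr F (Ident (Cat M) x) = Ident (Cat N) (FOb F x)"
    and FAr_Comp: "f \<in> hom (Cat M) x y \<Longrightarrow> g \<in> hom (Cat M) y z \<Longrightarrow>
      FAr F (Comp (Cat M) g f) = Comp (Cat N) (FAr F g) (FAr F f)"
    and F_Term: "FOb F (Term M) = Term N"
    and FTy: "x \<in> Obj (Cat M) \<Longrightarrow> A \<in> Sec (Ty M) x \<Longrightarrow> FTy F x A \<in> Sec (Ty N) (FOb F x)"
    and FTm: "x \<in> Obj (Cat M) \<Longrightarrow> a \<in> Sec (Tm M) x \<Longrightarrow> FTm F x a \<in> Sec (Tm N) (FOb F x)"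
    and FTy_Res: "f \<in> hom (Cat M) x y \<Longrightarrow> A \<in> Sec (Ty M) y \<Longrightarrow>
      FTy F x (Res (Ty M) f A) = Res (Ty N) (FAr F f) (FTy F y A)"
    and FTm_Res: "f \<in> hom (Cat M) x y \<Longrightarrow> a \<in> Sec (Tm M) y \<Longrightarrow>
      FTm F x (Res (Tm M) f a) = Res (Tm N) (FAr F f) (FTm F y a)"
    and F_typ_of: "x \<in> Obj (Cat M) \<Longrightarrow> a \<in> Sec (Tm M) x \<Longrightarrow>
      typ_of N (FOb F x) (FTm F x a) = FTy F x (typ_of M x a)"
    and F_Ext: "x \<in> Obj (Cat M) \<Longrightarrow> A \<in> Sec (Ty M) x \<Longrightarrow>
      FOb F (Ext M x A) = Ext N (FOb F x) (FTy F x A)"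
    and F_Pr: "x \<in> Obj (Cat M) \<Longrightarrow> A \<in> Sec (Ty M) x \<Longrightarrow>
      FAr F (Pr M x A) = Pr N (FOb F x) (FTy F x A)"
    and F_Qv: "x \<in> Obj (Cat M) \<Longrightarrow> A \<in> Sec (Ty M) x \<Longrightarrow>
      FTm F (Ext M x A) (Qv M x A) = Qv N (FOb F x) (FTy F x A)"


section \<open>Natural models with a family of basic types\<close>

text \<open>Objects and morphisms of the category of natural models equipped with an \<open>I\<close>-indexed family
  of basic types. This category has natural models over all types as objects, so it is not itself
  a \<open>cat_data\<close>; its hom-sets, identities and composition are polymorphic constants, and the
  category laws are the lemmas \<open>nmty_*\<close> below.\<close>

definition nmty_object :: "'i set \<Rightarrow> ('o, 'a, 'u, 'e) nm_data \<Rightarrow> ('i \<Rightarrow> 'u) \<Rightarrow> bool" where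
  "nmty_object I M Os \<longleftrightarrow> natural_model M \<and> Os \<in> I \<rightarrow> Sec (Ty M) (Term M)"

definition nmty_morphism :: "'i set \<Rightarrow> ('o, 'a, 'u, 'e) nm_data \<Rightarrow> ('i \<Rightarrow> 'u) \<Rightarrow>
    ('o2, 'a2, 'u2, 'e2) nm_data \<Rightarrow> ('i \<Rightarrow> 'u2) \<Rightarrow>
    ('o, 'a, 'u, 'e, 'o2, 'a2, 'u2, 'e2) nm_map \<Rightarrow> bool" where
  "nmty_morphism I M Os N Ps F \<longleftrightarrow> nmty_object I M Os \<and> nmty_object I N Ps \<and>
    nm_morphism M N F \<and> (\<forall>i\<in>I. FTy F (Term M) (Os i) = Ps i)"

definition nm_id :: "('o, 'a, 'u, 'e) nm_data \<Rightarrow> ('o, 'a, 'u, 'e, 'o, 'a, 'u, 'e) nm_map" where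
  "nm_id M = \<lparr>FOb = (\<lambda>x\<in>Obj (Cat M). x), FAr = (\<lambda>f\<in>Arr (Cat M). f),
    FTy = (\<lambda>x\<in>Obj (Cat M). \<lambda>A\<in>Sec (Ty M) x. A), FTm = (\<lambda>x\<in>Obj (Cat M). \<lambda>a\<in>Sec (Tm M) x. a)\<rparr>"

definition nm_comp :: "('o, 'a, 'u, 'e) nm_data \<Rightarrow>
    ('o2, 'a2, 'u2, 'e2, 'o3, 'a3, 'u3, 'e3) nm_map \<Rightarrow> ('o, 'a, 'u, 'e, 'o2, 'a2, 'u2, 'e2) nm_map \<Rightarrow>
    ('o, 'a, 'u, 'e, 'o3, 'a3, 'u3, 'e3) nm_map" where
  "nm_comp M G F = \<lparr>FOb = (\<lambda>x\<in>Obj (Cat M). FOb G (FOb F x)),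
    FAr = (\<lambda>f\<in>Arr (Cat M). FAr G (FAr F f)),
    FTy = (\<lambda>x\<in>Obj (Cat M). \<lambda>A\<in>Sec (Ty M) x. FTy G (FOb F x) (FTy F x A)),
    FTm = (\<lambda>x\<in>Obj (Cat M). \<lambda>a\<in>Sec (Tm M) x. FTm G (FOb F x) (FTm F x a))\<rparr>"


section \<open>The natural model of finite sets over \<open>I\<close>\<close>

text \<open>The pair \<open>(n, u)\<close> stands for \<open>u : {0, ..., n-1} \<rightarrow> I\<close>. An arrow from \<open>x\<close> to \<open>y\<close> is a triple
  \<open>(x, f, y)\<close> where, because of the opposite category, \<open>f\<close> is a function over \<open>I\<close> from the
  finite set of \<open>y\<close> to that of \<open>x\<close>. Functions are extensional (\<open>undefined\<close> outside their domain),
  so that equality of objects and arrows is equality in HOL.\<close>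

type_synonym 'i fin_obj = "nat \<times> (nat \<Rightarrow> 'i)"
type_synonym 'i fin_arr = "'i fin_obj \<times> (nat \<Rightarrow> nat) \<times> 'i fin_obj"

definition fin_objs :: "'i set \<Rightarrow> 'i fin_obj set" where
  "fin_objs I = {(n, u). u \<in> {..<n} \<rightarrow>\<^sub>E I}"

definition fin_arrs :: "'i set \<Rightarrow> 'i fin_arr set" where
  "fin_arrs I = {((n, u), f, (m, v)). (n, u) \<in> fin_objs I \<and> (m, v) \<in> fin_objs I \<and>
    f \<in> {..<m} \<rightarrow>\<^sub>E {..<n} \<and> (\<forall>k<m. u (f k) = v k)}"

definition fin_cat :: "'i set \<Rightarrow> ('i fin_obj, 'i fin_arr) cat_data" where
  "fin_cat I = \<lparr>Obj = fin_objs I, Arr = fin_arrs I,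
    Src = (\<lambda>(x, f, y). x), Tgt = (\<lambda>(x, f, y). y),
    Ident = (\<lambda>x. (x, (\<lambda>k\<in>{..<fst x}. k), x)),
    Comp = (\<lambda>(y, g, z) (x, f, y'). (x, (\<lambda>k\<in>{..<fst z}. f (g k)), z))\<rparr>"

definition fin_model :: "'i set \<Rightarrow> ('i fin_obj, 'i fin_arr, 'i, nat) nm_data" where
  "fin_model I = \<lparr>Cat = fin_cat I, Term = (0, \<lambda>_. undefined),
    Ty = \<lparr>Sec = (\<lambda>_. I), Res = (\<lambda>_ j. j)\<rparr>,
    Tm = \<lparr>Sec = (\<lambda>(n, u). {..<n}), Res = (\<lambda>(x, f, y) k. f k)\<rparr>,
    typ_of = (\<lambda>(n, u) k. u k),
    Ext = (\<lambda>(n, u) j. (Suc n, u(n := j))),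
    Pr = (\<lambda>(n, u) j. ((Suc n, u(n := j)), (\<lambda>k\<in>{..<n}. k), (n, u))),
    Qv = (\<lambda>(n, u) j. n)\<rparr>"


section \<open>Basic facts\<close>

lemma hom_iff: "f \<in> hom C x y \<longleftrightarrow> f \<in> Arr C \<and> Src C f = x \<and> Tgt C f = y"
  by (simp add: hom_def)

lemma (in category) hom_Obj: "f \<in> hom C x y \<Longrightarrow> x \<in> Obj C \<and> y \<in> Obj C"
  using Src_Obj Tgt_Obj by (auto simp: hom_iff)

lemma (in category) presheaf_yon:
  assumes "x \<in> Obj C"
  shows "presheaf C (yon C x)"
proof
  show "Res (yon C x) f s \<in> Sec (yon C x) w"
    if "f \<in> hom C w v" "s \<in> Sec (yon C x) v" for f s v w
    using that Comp_hom[of f w v s x] by (simp add: yon_def)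
  show "Res (yon C x) (Ident C w) s = s" if "s \<in> Sec (yon C x) w" for s w
    using that Comp_Ident_right[of s w x] by (simp add: yon_def)
  show "Res (yon C x) (Comp C g f) s = Res (yon C x) f (Res (yon C x) g s)"
    if "f \<in> hom C u v" "g \<in> hom C v w" "s \<in> Sec (yon C x) w" for f g s u v w
    using that Comp_assoc[of f u v g w s x] by (simp add: yon_def)
qed

lemma (in presheaf) nat_trans_elem_map:
  assumes x: "x \<in> Obj C" and a: "a \<in> Sec P x"
  shows "nat_trans C (yon C x) P (elem_map P a)"
proof -
  interpret Y: presheaf C "yon C x" by (rule presheaf_yon[OF x])
  show ?thesis
  proof
    show "elem_map P a w s \<in> Sec P w" if "s \<in> Sec (yon C x) w" for s w
      using that Res_Sec[of s w x a] a by (simp add: yon_def elem_map_def)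
    show "elem_map P a w (Res (yon C x) f s) = Res P f (elem_map P a v s)"
      if "f \<in> hom C w v" "s \<in> Sec (yon C x) v" for f s v w
      using that Res_Comp[of f w v s x a] a by (simp add: yon_def elem_map_def)
  qed
qed

lemma (in category) nat_trans_yon_map:
  assumes f: "f \<in> hom C x y"
  shows "nat_trans C (yon C x) (yon C y) (yon_map C f)"
proof -
  have xy: "x \<in> Obj C" "y \<in> Obj C" using hom_Obj[OF f] by auto
  interpret X: presheaf C "yon C x" by (rule presheaf_yon[OF xy(1)])
  interpret Y: presheaf C "yon C y" by (rule presheaf_yon[OF xy(2)])
  show ?thesis
  proof
    show "yon_map C f w s \<in> Sec (yon C y) w" if "s \<in> Sec (yon C x) w" for s w
      using that Comp_hom[of s w x f y] f by (simp add: yon_def yon_map_def)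
    show "yon_map C f w (Res (yon C x) g s) = Res (yon C y) g (yon_map C f v s)"
      if "g \<in> hom C w v" "s \<in> Sec (yon C x) v" for g s v w
      using that Comp_assoc[of g w v s x f y] f by (simp add: yon_def yon_map_def)
  qed
qed

text \<open>A commuting square of presheaves is a pullback iff its components are pullbacks of sets.\<close>

lemma pullback_square_pointwiseD:
  assumes pb: "pullback_square C P X Y Z h k f g"
    and w: "w \<in> Obj C" and a: "a \<in> Sec X w" and b: "b \<in> Sec Y w" and ab: "f w a = g w b"
  shows "\<exists>!c. c \<in> Sec P w \<and> h w c = a \<and> k w c = b"
proof -
  have nh: "nat_trans C P X h" and nk: "nat_trans C P Y k" and nf: "nat_trans C X Z f"
    and ng: "nat_trans C Y Z g"
    using pb by (simp_all add: pullback_square_def)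
  interpret h: nat_trans C P X h by (rule nh)
  interpret k: nat_trans C P Y k by (rule nk)
  interpret f: nat_trans C X Z f by (rule nf)
  interpret g: nat_trans C Y Z g by (rule ng)
  let ?T = "yon C w" and ?s = "elem_map X a" and ?t = "elem_map Y b"
  have id: "Ident C w \<in> hom C w w" by (rule h.dom.Ident_hom[OF w])
  have idT: "Ident C w \<in> Sec ?T w" using id by (simp add: yon_def)
  have ns: "nat_trans C ?T X ?s" by (rule h.cod.nat_trans_elem_map[OF w a])
  have nt: "nat_trans C ?T Y ?t" by (rule k.cod.nat_trans_elem_map[OF w b])
  have cm: "commuting_square C ?T ?s ?t f g"
    unfolding commuting_square_def
  proof (intro ballI)
    fix v r assume "r \<in> Sec (yon C w) v"
    then have r: "r \<in> hom C v w" by (simp add: yon_def)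
    show "f v (elem_map X a v r) = g v (elem_map Y b v r)"
      using f.naturality[OF r a] g.naturality[OF r b] ab by (simp add: elem_map_def)
  qed
  have ex: "\<exists>m. mediating C P h k ?T ?s ?t m"
    and un: "\<And>m m'. mediating C P h k ?T ?s ?t m \<Longrightarrow> mediating C P h k ?T ?s ?t m' \<Longrightarrow>
        m w (Ident C w) = m' w (Ident C w)"
    using pb ns nt cm w idT unfolding pullback_square_def by blast+
  obtain m where m: "mediating C P h k ?T ?s ?t m" using ex by blast
  then have nm: "nat_trans C ?T P m" by (simp add: mediating_def)
  let ?c = "m w (Ident C w)"
  have c: "?c \<in> Sec P w \<and> h w ?c = a \<and> k w ?c = b"
    using m w idT nat_trans.component[OF nm w idT] h.cod.Res_Ident[OF w a] k.cod.Res_Ident[OF w b]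
    by (simp add: mediating_def elem_map_def)
  have "c' = ?c" if c': "c' \<in> Sec P w" "h w c' = a" "k w c' = b" for c'
  proof -
    have "mediating C P h k ?T ?s ?t (elem_map P c')"
      unfolding mediating_def
    proof (intro conjI ballI)
      show "nat_trans C ?T P (elem_map P c')" by (rule h.dom.nat_trans_elem_map[OF w c'(1)])
      fix v r assume "r \<in> Sec (yon C w) v"
      then have r: "r \<in> hom C v w" by (simp add: yon_def)
      show "h v (elem_map P c' v r) = elem_map X a v r"
        using h.naturality[OF r c'(1)] c' by (simp add: elem_map_def)
      show "k v (elem_map P c' v r) = elem_map Y b v r"
        using k.naturality[OF r c'(1)] c' by (simp add: elem_map_def)
    qed
    from un[OF this m] show ?thesis
      using h.dom.Res_Ident[OF w c'(1)] by (simp add: elem_map_def)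
  qed
  with c show ?thesis by blast
qed

lemma pointwise_mediating:
  fixes T :: "('o, 'a, 't) psh_data"
  assumes h: "nat_trans C P X h" and k: "nat_trans C P Y k"
    and pw: "\<forall>w\<in>Obj C. \<forall>a\<in>Sec X w. \<forall>b\<in>Sec Y w. f w a = g w b \<longrightarrow>
      (\<exists>!c. c \<in> Sec P w \<and> h w c = a \<and> k w c = b)"
    and s: "nat_trans C T X s" and t: "nat_trans C T Y t" and cm: "commuting_square C T s t f g"
  shows "\<exists>m. mediating C P h k T s t m"
    and "mediating C P h k T s t m1 \<Longrightarrow> mediating C P h k T s t m2 \<Longrightarrow>
      w \<in> Obj C \<Longrightarrow> c \<in> Sec T w \<Longrightarrow> m1 w c = m2 w c"
proof -
  interpret h: nat_trans C P X h by (rule h)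
  interpret k: nat_trans C P Y k by (rule k)
  interpret s: nat_trans C T X s by (rule s)
  interpret t: nat_trans C T Y t by (rule t)
  have pw': "\<exists>!d. d \<in> Sec P w \<and> h w d = s w c \<and> k w d = t w c"
    if "w \<in> Obj C" "c \<in> Sec T w" for w c
    using pw[rule_format, OF that(1) s.component[OF that] t.component[OF that]] cm that
    by (simp add: commuting_square_def)
  define m where "m = (\<lambda>w c. THE d. d \<in> Sec P w \<and> h w d = s w c \<and> k w d = t w c)"
  have m: "m w c \<in> Sec P w \<and> h w (m w c) = s w c \<and> k w (m w c) = t w c"
    if "w \<in> Obj C" "c \<in> Sec T w" for w c
    unfolding m_def by (rule theI'[OF pw'[OF that]])
  have "nat_trans C T P m"
  proof
    show "m w c \<in> Sec P w" if "w \<in> Obj C" "c \<in> Sec T w" for w c using m[OF that] by simp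
    fix r x y c assume r: "r \<in> hom C x y" and c: "c \<in> Sec T y"
    have xy: "x \<in> Obj C" "y \<in> Obj C" using h.dom.hom_Obj[OF r] by auto
    have cx: "Res T r c \<in> Sec T x" by (rule s.dom.Res_Sec[OF r c])
    have my: "m y c \<in> Sec P y" "h y (m y c) = s y c" "k y (m y c) = t y c"
      using m[OF xy(2) c] by auto
    have "Res P r (m y c) \<in> Sec P x \<and> h x (Res P r (m y c)) = s x (Res T r c) \<and>
        k x (Res P r (m y c)) = t x (Res T r c)"
      using h.dom.Res_Sec[OF r my(1)] h.naturality[OF r my(1)] k.naturality[OF r my(1)]
        s.naturality[OF r c] t.naturality[OF r c] my by simp
    then show "m x (Res T r c) = Res P r (m y c)"
      using pw'[OF xy(1) cx] m[OF xy(1) cx] by blast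
  qed
  then show "\<exists>m. mediating C P h k T s t m"
    using m by (auto simp: mediating_def)
  show "m1 w c = m2 w c"
    if m1: "mediating C P h k T s t m1" and m2: "mediating C P h k T s t m2"
      and w: "w \<in> Obj C" and c: "c \<in> Sec T w"
  proof -
    have "m1 w c \<in> Sec P w" "m2 w c \<in> Sec P w"
      using m1 m2 w c by (auto simp: mediating_def nat_trans.component)
    then show ?thesis
      using m1 m2 w c pw'[OF w c] unfolding mediating_def by blast
  qed
qed

lemma pullback_square_iff_pointwise:
  "pullback_square C P X Y Z h k f g \<longleftrightarrow>
    nat_trans C P X h \<and> nat_trans C P Y k \<and> nat_trans C X Z f \<and> nat_trans C Y Z g \<and>
    commuting_square C P h k f g \<and>
    (\<forall>w\<in>Obj C. \<forall>a\<in>Sec X w. \<forall>b\<in>Sec Y w. f w a = g w b \<longrightarrow>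
      (\<exists>!c. c \<in> Sec P w \<and> h w c = a \<and> k w c = b))"
  (is "?L \<longleftrightarrow> ?R")
proof
  assume L: ?L
  then show ?R
    using pullback_square_pointwiseD[OF L] by (simp add: pullback_square_def)
next
  assume R: ?R
  then have h: "nat_trans C P X h" and k: "nat_trans C P Y k"
    and pw: "\<forall>w\<in>Obj C. \<forall>a\<in>Sec X w. \<forall>b\<in>Sec Y w. f w a = g w b \<longrightarrow>
      (\<exists>!c. c \<in> Sec P w \<and> h w c = a \<and> k w c = b)"
    by blast+
  note univ = pointwise_mediating[OF h k pw]
  have "(\<exists>m. mediating C P h k T s t m) \<and>
      (\<forall>m m'. mediating C P h k T s t m \<longrightarrow> mediating C P h k T s t m' \<longrightarrow>
        (\<forall>w\<in>Obj C. \<forall>c\<in>Sec T w. m w c = m' w c))"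
    if "nat_trans C T X s" "nat_trans C T Y t" "commuting_square C T s t f g"
    for T :: "('a, 'b, 'b) psh_data" and s t
    using univ(1)[OF that] univ(2)[OF that] by blast
  with R show ?L
    unfolding pullback_square_def by simp
qed

text \<open>The universal property for test presheaves over an arbitrary type \<open>'t\<close>.\<close>

lemma pullback_square_universal:
  fixes T :: "('o, 'a, 't) psh_data"
  assumes pb: "pullback_square C P X Y Z h k f g"
    and st: "nat_trans C T X s" "nat_trans C T Y t" "commuting_square C T s t f g"
  shows "\<exists>m. mediating C P h k T s t m"
    and "mediating C P h k T s t m \<Longrightarrow> mediating C P h k T s t m' \<Longrightarrow>
      w \<in> Obj C \<Longrightarrow> c \<in> Sec T w \<Longrightarrow> m w c = m' w c"
proof -
  have h: "nat_trans C P X h" and k: "nat_trans C P Y k"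
    and pw: "\<forall>w\<in>Obj C. \<forall>a\<in>Sec X w. \<forall>b\<in>Sec Y w. f w a = g w b \<longrightarrow>
      (\<exists>!c. c \<in> Sec P w \<and> h w c = a \<and> k w c = b)"
    using pb pullback_square_pointwiseD[OF pb] by (simp_all add: pullback_square_def)
  note * = pointwise_mediating[OF h k pw st]
  show "\<exists>m. mediating C P h k T s t m" by (rule *(1))
  show "m w c = m' w c" if "mediating C P h k T s t m" "mediating C P h k T s t m'"
      "w \<in> Obj C" "c \<in> Sec T w"
    using that by (rule *(2))
qed

lemma nm_morphism_nm_id:
  assumes "natural_model M"
  shows "nm_morphism M M (nm_id M)"
proof -
  interpret natural_model M by (rule assms)
  interpret C: category "Cat M" by (rule Cat)
  interpret Ty: presheaf "Cat M" "Ty M" by (rule Ty)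
  interpret Tm: presheaf "Cat M" "Tm M" by (rule Tm)
  interpret typ_of: nat_trans "Cat M" "Tm M" "Ty M" "typ_of M" by (rule typ_of)
  have hA: "f \<in> Arr (Cat M)" if "f \<in> hom (Cat M) x y" for f x y
    using that by (simp add: hom_iff)
  show ?thesis
  proof
    show "FAr (nm_id M) f \<in> hom (Cat M) (FOb (nm_id M) x) (FOb (nm_id M) y)"
      if f: "f \<in> hom (Cat M) x y" for f x y
      using C.hom_Obj[OF f] f by (simp add: nm_id_def hA[OF f])
    show "FAr (nm_id M) (Ident (Cat M) x) = Ident (Cat M) (FOb (nm_id M) x)"
      if "x \<in> Obj (Cat M)" for x
      using that hA[OF C.Ident_hom[OF that]] by (simp add: nm_id_def)
    show "FAr (nm_id M) (Comp (Cat M) g f) = Comp (Cat M) (FAr (nm_id M) g) (FAr (nm_id M) f)"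
      if f: "f \<in> hom (Cat M) x y" and g: "g \<in> hom (Cat M) y z" for f g x y z
      by (simp add: nm_id_def hA[OF f] hA[OF g] hA[OF C.Comp_hom[OF f g]])
    show "FOb (nm_id M) (Term M) = Term M"
      using Term by (simp add: nm_id_def terminal_object_def)
    show "FTy (nm_id M) x (Res (Ty M) f A) = Res (Ty M) (FAr (nm_id M) f) (FTy (nm_id M) y A)"
      if f: "f \<in> hom (Cat M) x y" and A: "A \<in> Sec (Ty M) y" for f x y A
      using C.hom_Obj[OF f] Ty.Res_Sec[OF f A] A by (simp add: nm_id_def hA[OF f])
    show "FTm (nm_id M) x (Res (Tm M) f a) = Res (Tm M) (FAr (nm_id M) f) (FTm (nm_id M) y a)"
      if f: "f \<in> hom (Cat M) x y" and a: "a \<in> Sec (Tm M) y" for f x y a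
      using C.hom_Obj[OF f] Tm.Res_Sec[OF f a] a by (simp add: nm_id_def hA[OF f])
    show "FAr (nm_id M) (Pr M x A) = Pr M (FOb (nm_id M) x) (FTy (nm_id M) x A)"
      if "x \<in> Obj (Cat M)" "A \<in> Sec (Ty M) x" for x A
      using that hA[OF Pr[OF that]] by (simp add: nm_id_def)
  qed (simp_all add: nm_id_def Ext Qv typ_of.component)
qed

lemma nm_morphism_nm_comp:
  assumes "nm_morphism M N F" and "nm_morphism N K G"
  shows "nm_morphism M K (nm_comp M G F)"
proof -
  interpret F: nm_morphism M N F by (rule assms)
  interpret G: nm_morphism N K G by (rule assms)
  interpret C: category "Cat M" by (rule F.M.Cat)
  interpret Ty: presheaf "Cat M" "Ty M" by (rule F.M.Ty)
  interpret Tm: presheaf "Cat M" "Tm M" by (rule F.M.Tm)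
  interpret typ_of: nat_trans "Cat M" "Tm M" "Ty M" "typ_of M" by (rule F.M.typ_of)
  have hA: "f \<in> Arr (Cat M)" if "f \<in> hom (Cat M) x y" for f x y
    using that by (simp add: hom_iff)
  note simps = nm_comp_def F.FOb F.FTy F.FTm F.F_Ext F.F_Pr F.F_Qv F.F_typ_of
    G.FOb G.FTy G.FTm G.F_Ext G.F_Pr G.F_typ_of F.FAr_Ident G.FAr_Ident F.F_Term G.F_Term
    F.M.Ext F.M.Qv typ_of.component
  show ?thesis
  proof
    show "FAr (nm_comp M G F) f \<in> hom (Cat K) (FOb (nm_comp M G F) x) (FOb (nm_comp M G F) y)"
      if f: "f \<in> hom (Cat M) x y" for f x y
      using G.FAr[OF F.FAr[OF f]] C.hom_Obj[OF f] by (simp add: simps hA[OF f])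
    show "FAr (nm_comp M G F) (Comp (Cat M) g f) =
        Comp (Cat K) (FAr (nm_comp M G F) g) (FAr (nm_comp M G F) f)"
      if f: "f \<in> hom (Cat M) x y" and g: "g \<in> hom (Cat M) y z" for f g x y z
      using G.FAr_Comp[OF F.FAr[OF f] F.FAr[OF g]] hA[OF C.Comp_hom[OF f g]]
      by (simp add: nm_comp_def hA[OF f] hA[OF g] F.FAr_Comp[OF f g])
    show "FTy (nm_comp M G F) x (Res (Ty M) f A) =
        Res (Ty K) (FAr (nm_comp M G F) f) (FTy (nm_comp M G F) y A)"
      if f: "f \<in> hom (Cat M) x y" and A: "A \<in> Sec (Ty M) y" for f x y A
      using C.hom_Obj[OF f] G.FTy_Res[OF F.FAr[OF f] F.FTy[OF _ A]] Ty.Res_Sec[OF f A]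
      by (simp add: nm_comp_def hA[OF f] A F.FTy_Res[OF f A])
    show "FTm (nm_comp M G F) x (Res (Tm M) f A) =
        Res (Tm K) (FAr (nm_comp M G F) f) (FTm (nm_comp M G F) y A)"
      if f: "f \<in> hom (Cat M) x y" and A: "A \<in> Sec (Tm M) y" for f x y A
      using C.hom_Obj[OF f] G.FTm_Res[OF F.FAr[OF f] F.FTm[OF _ A]] Tm.Res_Sec[OF f A]
      by (simp add: nm_comp_def hA[OF f] A F.FTm_Res[OF f A])
    show "FAr (nm_comp M G F) (Ident (Cat M) x) = Ident (Cat K) (FOb (nm_comp M G F) x)"
      if "x \<in> Obj (Cat M)" for x
      using that hA[OF C.Ident_hom[OF that]] by (simp add: simps)
    show "FAr (nm_comp M G F) (Pr M x A) =
        Pr K (FOb (nm_comp M G F) x) (FTy (nm_comp M G F) x A)"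
      if "x \<in> Obj (Cat M)" "A \<in> Sec (Ty M) x" for x A
      using that hA[OF F.M.Pr[OF that]] by (simp add: simps)
    show "FTm (nm_comp M G F) (Ext M x A) (Qv M x A) =
        Qv K (FOb (nm_comp M G F) x) (FTy (nm_comp M G F) x A)"
      if xA: "x \<in> Obj (Cat M)" "A \<in> Sec (Ty M) x" for x A
      using G.F_Qv[OF F.FOb[OF xA(1)] F.FTy[OF xA]] xA F.M.Ext[OF xA] F.M.Qv[OF xA]
      by (simp add: nm_comp_def F.F_Qv F.F_Ext)
    show "FOb (nm_comp M G F) (Term M) = Term K"
      using F.M.Term by (simp add: simps terminal_object_def)
  qed (simp_all add: simps)
qed

lemma nmty_id:
  assumes "nmty_object I M Os"
  shows "nmty_morphism I M Os M Os (nm_id M)"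
proof -
  have M: "natural_model M" and Os: "Os \<in> I \<rightarrow> Sec (Ty M) (Term M)"
    using assms by (auto simp: nmty_object_def)
  have "Term M \<in> Obj (Cat M)"
    using natural_model.Term[OF M] by (simp add: terminal_object_def)
  then show ?thesis
    using assms nm_morphism_nm_id[OF M] Os by (auto simp: nmty_morphism_def nm_id_def)
qed

lemma nmty_comp:
  assumes F: "nmty_morphism I M Os N Ps F" and G: "nmty_morphism I N Ps K Qs G"
  shows "nmty_morphism I M Os K Qs (nm_comp M G F)"
proof -
  have M: "natural_model M" and Os: "Os \<in> I \<rightarrow> Sec (Ty M) (Term M)"
    and mF: "nm_morphism M N F" and mG: "nm_morphism N K G"
    using F G by (auto simp: nmty_morphism_def nmty_object_def)
  have "Term M \<in> Obj (Cat M)"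
    using natural_model.Term[OF M] by (simp add: terminal_object_def)
  then show ?thesis
    using F G nm_morphism_nm_comp[OF mF mG] Os nm_morphism.F_Term[OF mF]
    by (auto simp: nmty_morphism_def nm_comp_def)
qed

lemma nm_map_eqI:
  assumes "nm_morphism M N F" and "nm_morphism M N G"
    and "\<And>x. x \<in> Obj (Cat M) \<Longrightarrow> FOb F x = FOb G x"
    and "\<And>f. f \<in> Arr (Cat M) \<Longrightarrow> FAr F f = FAr G f"
    and "\<And>x A. x \<in> Obj (Cat M) \<Longrightarrow> A \<in> Sec (Ty M) x \<Longrightarrow> FTy F x A = FTy G x A"
    and "\<And>x a. x \<in> Obj (Cat M) \<Longrightarrow> a \<in> Sec (Tm M) x \<Longrightarrow> FTm F x a = FTm G x a"
  shows "F = G"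
proof -
  interpret F: nm_morphism M N F by (rule assms)
  interpret G: nm_morphism M N G by (rule assms)
  show ?thesis
  proof (rule nm_map.equality)
    show "FOb F = FOb G" by (rule extensionalityI[OF F.FOb_ext G.FOb_ext assms(3)])
    show "FAr F = FAr G" by (rule extensionalityI[OF F.FAr_ext G.FAr_ext assms(4)])
    show "FTy F = FTy G"
      by (intro extensionalityI[OF F.FTy_ext(1) G.FTy_ext(1)]
          extensionalityI[OF F.FTy_ext(2) G.FTy_ext(2)] assms(5))
    show "FTm F = FTm G"
      by (intro extensionalityI[OF F.FTm_ext(1) G.FTm_ext(1)]
          extensionalityI[OF F.FTm_ext(2) G.FTm_ext(2)] assms(6))
  qed simp
qed

lemma nmty_id_right:
  assumes "nmty_morphism I M Os N Ps F"
  shows "nm_comp M F (nm_id M) = F"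
proof -
  have F: "nm_morphism M N F" using assms by (simp add: nmty_morphism_def)
  then interpret F: nm_morphism M N F .
  show ?thesis
    by (rule nm_map_eqI[OF nm_morphism_nm_comp[OF nm_morphism_nm_id[OF F.M.natural_model_axioms] F] F])
      (simp_all add: nm_comp_def nm_id_def)
qed

lemma nmty_id_left:
  assumes "nmty_morphism I M Os N Ps F"
  shows "nm_comp M (nm_id N) F = F"
proof -
  have F: "nm_morphism M N F" using assms by (simp add: nmty_morphism_def)
  then interpret F: nm_morphism M N F .
  have "FAr F f \<in> Arr (Cat N)" if "f \<in> Arr (Cat M)" for f
    using F.FAr that by (auto simp: hom_iff)
  then show ?thesis
    by (intro nm_map_eqI[OF nm_morphism_nm_comp[OF F nm_morphism_nm_id[OF F.N.natural_model_axioms]] F])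
      (simp_all add: nm_comp_def nm_id_def F.FOb F.FTy F.FTm)
qed

lemma nmty_assoc:
  assumes "nmty_morphism I M Os N Ps F"
  shows "nm_comp M H (nm_comp M G F) = nm_comp M (nm_comp N H G) F"
proof -
  have "nm_morphism M N F" using assms by (simp add: nmty_morphism_def)
  then interpret F: nm_morphism M N F .
  have "FAr F f \<in> Arr (Cat N)" if "f \<in> Arr (Cat M)" for f
    using F.FAr that by (auto simp: hom_iff)
  then show ?thesis
    by (auto simp: nm_comp_def F.FOb F.FTy F.FTm fun_eq_iff restrict_def)
qed

lemma fin_cat_simps:
  "Obj (fin_cat I) = fin_objs I" "Arr (fin_cat I) = fin_arrs I"
  "Src (fin_cat I) (x, f, y) = x" "Tgt (fin_cat I) (x, f, y) = y"
  "Ident (fin_cat I) x = (x, (\<lambda>k\<in>{..<fst x}. k), x)"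
  "Comp (fin_cat I) (y, g, z) (x, f, y') = (x, (\<lambda>k\<in>{..<fst z}. f (g k)), z)"
  by (simp_all add: fin_cat_def)

lemma fin_model_simps:
  "Cat (fin_model I) = fin_cat I" "Term (fin_model I) = (0, \<lambda>_. undefined)"
  "Sec (Ty (fin_model I)) x = I" "Res (Ty (fin_model I)) F j = j"
  "Sec (Tm (fin_model I)) x = {..<fst x}" "Res (Tm (fin_model I)) (x, f, y) k = f k"
  "typ_of (fin_model I) x k = snd x k"
  "Ext (fin_model I) x j = (Suc (fst x), (snd x)(fst x := j))"
  "Pr (fin_model I) x j = ((Suc (fst x), (snd x)(fst x := j)), (\<lambda>k\<in>{..<fst x}. k), x)"
  "Qv (fin_model I) x j = fst x"
  by (simp_all add: fin_model_def split: prod.splits)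

lemma fin_hom_iff:
  "(x, f, y) \<in> hom (fin_cat I) x' y' \<longleftrightarrow> x' = x \<and> y' = y \<and> (x, f, y) \<in> fin_arrs I"
  "F \<in> hom (fin_cat I) x y \<longleftrightarrow> (\<exists>f. F = (x, f, y) \<and> (x, f, y) \<in> fin_arrs I)"
  by (auto simp: hom_iff fin_cat_simps, cases F, auto simp: fin_cat_simps)

lemma fin_arrs_iff: "(x, f, y) \<in> fin_arrs I \<longleftrightarrow> x \<in> fin_objs I \<and> y \<in> fin_objs I \<and>
    f \<in> {..<fst y} \<rightarrow>\<^sub>E {..<fst x} \<and> (\<forall>k<fst y. snd x (f k) = snd y k)"
  by (cases x; cases y) (simp add: fin_arrs_def)

lemma category_fin_cat: "category (fin_cat I)"
proof
  fix F assume "F \<in> Arr (fin_cat I)"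
  then show "Src (fin_cat I) F \<in> Obj (fin_cat I)" "Tgt (fin_cat I) F \<in> Obj (fin_cat I)"
    by (cases F; simp add: fin_cat_simps fin_arrs_iff)+
next
  fix x assume "x \<in> Obj (fin_cat I)"
  then show "Ident (fin_cat I) x \<in> hom (fin_cat I) x x"
    by (auto simp: fin_hom_iff fin_arrs_iff fin_cat_simps)
next
  fix F G x y z assume "F \<in> hom (fin_cat I) x y" "G \<in> hom (fin_cat I) y z"
  then obtain f g where FG: "F = (x, f, y)" "G = (y, g, z)"
    and *: "(x, f, y) \<in> fin_arrs I" "(y, g, z) \<in> fin_arrs I"
    by (auto simp: fin_hom_iff(2))
  have g: "g k < fst y" if "k < fst z" for k
    using *(2) that by (auto simp: fin_arrs_iff PiE_iff)
  then show "Comp (fin_cat I) G F \<in> hom (fin_cat I) x z"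
    using * by (auto simp: FG fin_hom_iff(1) fin_arrs_iff fin_cat_simps PiE_iff)
next
  fix F x y assume "F \<in> hom (fin_cat I) x y"
  then obtain f where F: "F = (x, f, y)" and f: "(x, f, y) \<in> fin_arrs I"
    by (auto simp: fin_hom_iff(2))
  have fe: "f \<in> extensional {..<fst y}" and fl: "\<And>k. k < fst y \<Longrightarrow> f k < fst x"
    using f by (auto simp: fin_arrs_iff PiE_iff)
  show "Comp (fin_cat I) (Ident (fin_cat I) y) F = F"
    using fe by (auto simp: F fin_cat_simps fun_eq_iff extensional_def restrict_def)
  show "Comp (fin_cat I) F (Ident (fin_cat I) x) = F"
    using fe fl by (auto simp: F fin_cat_simps fun_eq_iff extensional_def restrict_def)
next
  fix F G H w x y z
  assume "F \<in> hom (fin_cat I) w x" "G \<in> hom (fin_cat I) x y" "H \<in> hom (fin_cat I) y z"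
  then obtain f g h where FGH: "F = (w, f, x)" "G = (x, g, y)" "H = (y, h, z)"
    and h: "(y, h, z) \<in> fin_arrs I"
    by (auto simp: fin_hom_iff(2))
  have "h k < fst y" if "k < fst z" for k
    using h that by (auto simp: fin_arrs_iff PiE_iff)
  then show "Comp (fin_cat I) H (Comp (fin_cat I) G F) = Comp (fin_cat I) (Comp (fin_cat I) H G) F"
    by (auto simp: FGH fin_cat_simps fun_eq_iff restrict_def)
qed

lemma presheaf_fin_Ty: "presheaf (fin_cat I) (Ty (fin_model I))"
proof -
  interpret category "fin_cat I" by (rule category_fin_cat)
  show ?thesis by unfold_locales (auto simp: fin_model_simps)
qed

lemma presheaf_fin_Tm: "presheaf (fin_cat I) (Tm (fin_model I))"
proof -
  interpret category "fin_cat I" by (rule category_fin_cat)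
  show ?thesis
    by unfold_locales
      (auto simp: fin_model_simps fin_cat_simps fin_hom_iff fin_arrs_iff PiE_iff split: prod.splits)
qed


lemma nat_trans_fin_typ_of:
  "nat_trans (fin_cat I) (Tm (fin_model I)) (Ty (fin_model I)) (typ_of (fin_model I))"
proof -
  interpret Tm: presheaf "fin_cat I" "Tm (fin_model I)" by (rule presheaf_fin_Tm)
  interpret Ty: presheaf "fin_cat I" "Ty (fin_model I)" by (rule presheaf_fin_Ty)
  show ?thesis
  proof
    fix x a assume "x \<in> Obj (fin_cat I)" "a \<in> Sec (Tm (fin_model I)) x"
    then show "typ_of (fin_model I) x a \<in> Sec (Ty (fin_model I)) x"
      by (cases x) (auto simp: fin_model_simps fin_cat_simps fin_objs_def)
  next
    fix f x y a assume "f \<in> hom (fin_cat I) x y" "a \<in> Sec (Tm (fin_model I)) y"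
    then show "typ_of (fin_model I) x (Res (Tm (fin_model I)) f a) =
        Res (Ty (fin_model I)) f (typ_of (fin_model I) y a)"
      by (cases x; cases y) (auto simp: fin_model_simps fin_cat_simps fin_hom_iff fin_arrs_iff)
  qed
qed

lemma natural_model_fin_model: "natural_model (fin_model I)"
proof (rule natural_model.intro)
  let ?M = "fin_model I"
  have C: "Cat ?M = fin_cat I" by (simp add: fin_model_simps)
  interpret C: category "fin_cat I" by (rule category_fin_cat)
  interpret Ty: presheaf "fin_cat I" "Ty ?M" by (rule presheaf_fin_Ty)
  interpret Tm: presheaf "fin_cat I" "Tm ?M" by (rule presheaf_fin_Tm)
  show "category (Cat ?M)" unfolding C by (rule category_fin_cat)
  show "presheaf (Cat ?M) (Ty ?M)" unfolding C by (rule presheaf_fin_Ty)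
  show "presheaf (Cat ?M) (Tm ?M)" unfolding C by (rule presheaf_fin_Tm)
  show "nat_trans (Cat ?M) (Tm ?M) (Ty ?M) (typ_of ?M)" unfolding C by (rule nat_trans_fin_typ_of)
  show "terminal_object (Cat ?M) (Term ?M)"
    unfolding terminal_object_def
  proof (intro conjI ballI)
    show "Term ?M \<in> Obj (Cat ?M)" by (simp add: fin_model_simps fin_cat_simps fin_objs_def)
    fix x assume "x \<in> Obj (Cat ?M)"
    then show "\<exists>!f. f \<in> hom (Cat ?M) x (Term ?M)"
      by (intro ex1I[of _ "(x, \<lambda>_. undefined, Term ?M)"])
        (auto simp: fin_model_simps fin_cat_simps fin_objs_def fin_hom_iff fin_arrs_iff)
  qed
  fix x j assume x: "x \<in> Obj (Cat ?M)" and j: "j \<in> Sec (Ty ?M) x"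
  obtain n u where xnu: "x = (n, u)" by (cases x)
  show e: "Ext ?M x j \<in> Obj (Cat ?M)"
    using x j by (auto simp: fin_model_simps fin_cat_simps fin_objs_def PiE_iff extensional_def)
  show p: "Pr ?M x j \<in> hom (Cat ?M) (Ext ?M x j) x"
    using x e by (auto simp: fin_model_simps fin_cat_simps fin_hom_iff fin_arrs_iff)
  show q: "Qv ?M x j \<in> Sec (Tm ?M) (Ext ?M x j)"
    by (auto simp: fin_model_simps split: prod.splits)
  show "pullback_square (Cat ?M) (yon (Cat ?M) (Ext ?M x j)) (Tm ?M) (yon (Cat ?M) x) (Ty ?M)
        (elem_map (Tm ?M) (Qv ?M x j)) (yon_map (Cat ?M) (Pr ?M x j)) (typ_of ?M)
        (elem_map (Ty ?M) j)"
    unfolding pullback_square_iff_pointwise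
  proof (intro conjI ballI impI)
    show "nat_trans (Cat ?M) (yon (Cat ?M) (Ext ?M x j)) (Tm ?M) (elem_map (Tm ?M) (Qv ?M x j))"
      using Tm.nat_trans_elem_map e q unfolding C by blast
    show "nat_trans (Cat ?M) (yon (Cat ?M) (Ext ?M x j)) (yon (Cat ?M) x)
        (yon_map (Cat ?M) (Pr ?M x j))"
      using C.nat_trans_yon_map p unfolding C by blast
    show "nat_trans (Cat ?M) (Tm ?M) (Ty ?M) (typ_of ?M)"
      unfolding C by (rule nat_trans_fin_typ_of)
    show "nat_trans (Cat ?M) (yon (Cat ?M) x) (Ty ?M) (elem_map (Ty ?M) j)"
      using Ty.nat_trans_elem_map x j unfolding C by blast
    show "commuting_square (Cat ?M) (yon (Cat ?M) (Ext ?M x j)) (elem_map (Tm ?M) (Qv ?M x j))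
        (yon_map (Cat ?M) (Pr ?M x j)) (typ_of ?M) (elem_map (Ty ?M) j)"
      by (auto simp: xnu commuting_square_def yon_def yon_map_def elem_map_def fin_model_simps
          fin_cat_simps fin_hom_iff fin_arrs_iff)
    fix w a b assume w: "w \<in> Obj (Cat ?M)" and a: "a \<in> Sec (Tm ?M) w"
      and b: "b \<in> Sec (yon (Cat ?M) x) w"
      and ab: "typ_of ?M w a = elem_map (Ty ?M) j w b"
    obtain m v where wmv: "w = (m, v)" by (cases w)
    from b obtain f where bf: "b = (w, f, x)"
      by (auto simp: yon_def fin_hom_iff fin_model_simps fin_cat_simps split: prod.splits)
    have f: "f \<in> {..<n} \<rightarrow>\<^sub>E {..<m}" "\<And>k. k < n \<Longrightarrow> v (f k) = u k"
      using b by (auto simp: bf wmv xnu yon_def fin_hom_iff fin_model_simps fin_cat_simps fin_arrs_iff)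
    have am: "a < m" and va: "v a = j"
      using a ab by (auto simp: wmv elem_map_def fin_model_simps)
    let ?c = "(w, f(n := a), Ext ?M x j)"
    show "\<exists>!c. c \<in> Sec (yon (Cat ?M) (Ext ?M x j)) w \<and>
        elem_map (Tm ?M) (Qv ?M x j) w c = a \<and> yon_map (Cat ?M) (Pr ?M x j) w c = b"
    proof (rule ex1I[of _ ?c])
      have "?c \<in> Sec (yon (Cat ?M) (Ext ?M x j)) w"
        using w e f am va
        by (auto simp: wmv xnu yon_def fin_hom_iff fin_model_simps fin_cat_simps fin_arrs_iff PiE_iff
            extensional_def less_Suc_eq)
      moreover have "f k = undefined" if "\<not> k < n" for k
        using f(1) that by (auto simp: PiE_iff extensional_def)
      then have "yon_map (Cat ?M) (Pr ?M x j) w ?c = b"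
        by (auto simp: bf wmv xnu yon_map_def fin_model_simps fin_cat_simps restrict_def fun_eq_iff)
      ultimately show "?c \<in> Sec (yon (Cat ?M) (Ext ?M x j)) w \<and>
          elem_map (Tm ?M) (Qv ?M x j) w ?c = a \<and> yon_map (Cat ?M) (Pr ?M x j) w ?c = b"
        by (auto simp: xnu elem_map_def fin_model_simps)
      fix c assume c: "c \<in> Sec (yon (Cat ?M) (Ext ?M x j)) w \<and>
          elem_map (Tm ?M) (Qv ?M x j) w c = a \<and> yon_map (Cat ?M) (Pr ?M x j) w c = b"
      then obtain g where cg: "c = (w, g, Ext ?M x j)"
        by (auto simp: yon_def fin_hom_iff fin_model_simps fin_cat_simps split: prod.splits)
      have g: "g \<in> {..<Suc n} \<rightarrow>\<^sub>E {..<m}" "g n = a"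
        using c by (auto simp: cg wmv xnu yon_def fin_hom_iff elem_map_def fin_model_simps fin_cat_simps
            fin_arrs_iff)
      have gf: "g k = f k" if "k < n" for k
      proof -
        have "(\<lambda>k\<in>{..<n}. g ((\<lambda>k\<in>{..<n}. k) k)) = f"
          using c by (simp add: cg bf wmv xnu yon_map_def fin_model_simps fin_cat_simps)
        then show ?thesis using that by (metis lessThan_iff restrict_apply')
      qed
      have "g = f(n := a)"
      proof
        fix k show "g k = (f(n := a)) k"
          using g gf f(1) by (cases "k < n"; cases "k = n") (auto simp: PiE_iff extensional_def)
      qed
      then show "c = ?c" by (simp add: cg)
    qed
  qed
qed

lemma nmty_object_fin_model: "nmty_object I (fin_model I) (\<lambda>i. i)"
  by (simp add: nmty_object_def natural_model_fin_model fin_model_simps)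

end

theory Submission
  imports Defs
begin

text \<open>An object \<open>(n, u)\<close> must be sent to the context of \<open>n\<close> variables whose \<open>k\<close>-th variable has
  the basic type indexed by \<open>u k\<close>, and an element \<open>k < n\<close> to the \<open>k\<close>-th variable. The basic types
  are weakened from the empty context, so they are stable under substitution; iterating the
  pullback property of context extension, arrows into such a context are therefore the same as
  tuples of terms of the right basic types. This dictates the image of an arrow of \<open>Fin/I\<close>,
  which is a tuple of variables, and makes functoriality a consequence of uniqueness.\<close>

locale model_with_types = natural_model M
  for M :: "('o, 'a, 'u, 'e) nm_data" +
  fixes I :: "'i set" and Os :: "'i \<Rightarrow> 'u"
  assumes Os: "Os \<in> I \<rightarrow> Sec (Ty M) (Term M)"
begin

sublocale C: category "Cat M" by (rule Cat)
sublocale Ty: presheaf "Cat M" "Ty M" by (rule Ty)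
sublocale Tm: presheaf "Cat M" "Tm M" by (rule Tm)
sublocale typ_of: nat_trans "Cat M" "Tm M" "Ty M" "typ_of M" by (rule typ_of)

section \<open>Basic types over arbitrary contexts, and arrows into a context extension\<close>

lemma Term_Obj: "Term M \<in> Obj (Cat M)"
  using Term by (simp add: terminal_object_def)

definition bang :: "'o \<Rightarrow> 'a" where
  "bang x = (THE f. f \<in> hom (Cat M) x (Term M))"

lemma ex1_to_Term: "x \<in> Obj (Cat M) \<Longrightarrow> \<exists>!f. f \<in> hom (Cat M) x (Term M)"
  using Term by (simp add: terminal_object_def)

lemma bang_hom: "x \<in> Obj (Cat M) \<Longrightarrow> bang x \<in> hom (Cat M) x (Term M)"
  unfolding bang_def by (rule theI'[OF ex1_to_Term])

lemma bang_unique: "f \<in> hom (Cat M) x (Term M) \<Longrightarrow> f = bang x"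
  using ex1_to_Term bang_hom C.hom_Obj by blast

text \<open>Weakening \<open>Os i\<close> from the empty context is the only choice: the types of
  \<open>fin_model I\<close> form a constant presheaf, so a morphism F that sends i to
  \<open>Os i\<close> at the terminal object must take i over x to
  \<open>basic_ty (FOb F x) i\<close>.\<close>

definition basic_ty :: "'o \<Rightarrow> 'i \<Rightarrow> 'u" where
  "basic_ty x i = Res (Ty M) (bang x) (Os i)"

lemma basic_ty_Sec: "x \<in> Obj (Cat M) \<Longrightarrow> i \<in> I \<Longrightarrow> basic_ty x i \<in> Sec (Ty M) x"
  unfolding basic_ty_def using Ty.Res_Sec[OF bang_hom] Os by blast

text \<open>Stability under substitution, since the arrow from x through y to the terminal object
  can only be \<open>bang x\<close>.\<close>

lemma Res_basic_ty:
  assumes "f \<in> hom (Cat M) x y" and "i \<in> I"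
  shows "Res (Ty M) f (basic_ty y i) = basic_ty x i"
proof -
  have y: "bang y \<in> hom (Cat M) y (Term M)" using assms C.hom_Obj bang_hom by blast
  have "bang x = Comp (Cat M) (bang y) f"
    using bang_unique[OF C.Comp_hom[OF assms(1) y]] by simp
  then show ?thesis
    by (simp add: basic_ty_def Ty.Res_Comp[OF assms(1) y Pi_mem[OF Os assms(2)]])
qed

lemma basic_ty_Term: "i \<in> I \<Longrightarrow> basic_ty (Term M) i = Os i"
  unfolding basic_ty_def
  using bang_unique[OF C.Ident_hom[OF Term_Obj]] Ty.Res_Ident[OF Term_Obj, of "Os i"] Os by auto

text \<open>The pullback property is pointwise, and at w the sections of the representables are
  arrows. Hence arrows into an extension are pairs of an arrow into x and a term of the substituted
  type.\<close>

lemma ex1_to_Ext: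
  assumes "x \<in> Obj (Cat M)" and "A \<in> Sec (Ty M) x" and "b \<in> hom (Cat M) w x"
    and "a \<in> Sec (Tm M) w" and "typ_of M w a = Res (Ty M) b A"
  shows "\<exists>!c. c \<in> hom (Cat M) w (Ext M x A) \<and> Res (Tm M) c (Qv M x A) = a \<and>
    Comp (Cat M) (Pr M x A) c = b"
  using pullback_square_pointwiseD[OF pullback[OF assms(1,2)], of w a b] assms C.hom_Obj[OF assms(3)]
  by (simp add: yon_def elem_map_def yon_map_def)

text \<open>Yoneda: evaluate the commuting square at the identity of
  \<open>Ext M x A\<close>.\<close>

lemma typ_of_Qv:
  assumes "x \<in> Obj (Cat M)" and "A \<in> Sec (Ty M) x"
  shows "typ_of M (Ext M x A) (Qv M x A) = Res (Ty M) (Pr M x A) A"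
proof -
  note e = Ext[OF assms]
  have "typ_of M w (Res (Tm M) c (Qv M x A)) = Res (Ty M) (Comp (Cat M) (Pr M x A) c) A"
    if "w \<in> Obj (Cat M)" "c \<in> hom (Cat M) w (Ext M x A)" for w c
    using pullback[OF assms] that
    by (simp add: pullback_square_def commuting_square_def yon_def elem_map_def yon_map_def)
  from this[OF e C.Ident_hom[OF e]] show ?thesis
    by (simp add: Tm.Res_Ident[OF e Qv[OF assms]] C.Comp_Ident_right[OF Pr[OF assms]])
qed

section \<open>Contexts of basic types, their variables, and the arrows into them\<close>

primrec ctx :: "nat \<Rightarrow> (nat \<Rightarrow> 'i) \<Rightarrow> 'o" where
  "ctx 0 u = Term M"
| "ctx (Suc n) u = Ext M (ctx n u) (basic_ty (ctx n u) (u n))"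

text \<open>Variables are numbered by de Bruijn levels: appending a type keeps the numbers of the
  earlier ones, in accordance with the inclusion that \<open>fin_model I\<close> uses as
  projection.\<close>

primrec var :: "nat \<Rightarrow> (nat \<Rightarrow> 'i) \<Rightarrow> nat \<Rightarrow> 'e" where
  "var 0 u k = undefined"
| "var (Suc n) u k = (if k = n then Qv M (ctx n u) (basic_ty (ctx n u) (u n))
    else Res (Tm M) (Pr M (ctx n u) (basic_ty (ctx n u) (u n))) (var n u k))"

text \<open>Objects of \<open>fin_model I\<close> carry extensional functions, while the recursion
  passes u on unchanged. Only entries below n are read, so updating u at n or restricting it to
  these entries is harmless.\<close>

lemma ctx_cong: "(\<And>k. k < n \<Longrightarrow> u k = v k) \<Longrightarrow> ctx n u = ctx n v"
  by (induction n) auto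

lemma var_cong: "(\<And>k. k < n \<Longrightarrow> u k = v k) \<Longrightarrow> var n u k = var n v k"
  by (induction n) (auto simp: ctx_cong[of _ u v])

lemma ctx_Obj: "(\<And>k. k < n \<Longrightarrow> u k \<in> I) \<Longrightarrow> ctx n u \<in> Obj (Cat M)"
  by (induction n) (auto intro: Term_Obj Ext basic_ty_Sec)

text \<open>The newest variable is typed by the generic term and the older ones by naturality of
  \<open>typ_of\<close>. Either type is a restriction along the projection, which stability turns
  into a basic type.\<close>

lemma var_Sec_typ_of:
  assumes "\<And>k. k < n \<Longrightarrow> u k \<in> I" and "k < n"
  shows "var n u k \<in> Sec (Tm M) (ctx n u) \<and>
    typ_of M (ctx n u) (var n u k) = basic_ty (ctx n u) (u k)"
  using assms
proof (induction n)
  case (Suc n)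
  have o: "ctx n u \<in> Obj (Cat M)" using Suc.prems by (auto intro: ctx_Obj)
  have ty: "basic_ty (ctx n u) (u n) \<in> Sec (Ty M) (ctx n u)"
    using o Suc.prems by (auto intro: basic_ty_Sec)
  note p = Pr[OF o ty]
  show ?case
  proof (cases "k = n")
    case True
    then show ?thesis
      using Qv[OF o ty] typ_of_Qv[OF o ty] Res_basic_ty[OF p] Suc.prems by simp
  next
    case False
    then have IH: "var n u k \<in> Sec (Tm M) (ctx n u)"
        "typ_of M (ctx n u) (var n u k) = basic_ty (ctx n u) (u k)"
      using Suc by auto
    show ?thesis
      using False Tm.Res_Sec[OF p IH(1)] typ_of.naturality[OF p IH(1)] IH(2)
        Res_basic_ty[OF p] Suc.prems by simp
  qed
qed simp

lemmas var_Sec = var_Sec_typ_of[THEN conjunct1]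
  and typ_of_var = var_Sec_typ_of[THEN conjunct2]

text \<open>Induction on n: the first n terms give an arrow into the shorter context, and the
  pullback property adds the last term. As basic types are stable, the typing of each term mentions
  only w and not the arrow built from the earlier terms.\<close>

lemma ex1_to_ctx:
  assumes w: "w \<in> Obj (Cat M)" and v: "\<And>k. k < n \<Longrightarrow> v k \<in> I"
    and a: "\<And>k. k < n \<Longrightarrow> a k \<in> Sec (Tm M) w"
    and t: "\<And>k. k < n \<Longrightarrow> typ_of M w (a k) = basic_ty w (v k)"
  shows "\<exists>!s. s \<in> hom (Cat M) w (ctx n v) \<and> (\<forall>k<n. Res (Tm M) s (var n v k) = a k)"
  using v a t
proof (induction n)
  case 0
  then show ?case using ex1_to_Term[OF w] by simp
next
  case (Suc n)
  let ?x = "ctx n v" and ?A = "basic_ty (ctx n v) (v n)"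
  have o: "?x \<in> Obj (Cat M)" using Suc.prems by (auto intro: ctx_Obj)
  have ty: "?A \<in> Sec (Ty M) ?x" using o Suc.prems by (auto intro: basic_ty_Sec)
  have vs: "var n v k \<in> Sec (Tm M) ?x" if "k < n" for k
    using Suc.prems that by (intro var_Sec) auto
  note p = Pr[OF o ty]
  \<comment> \<open>The older variables are weakened along the projection, so s acts on them through
    its composite with the projection.\<close>
  have Res_var: "Res (Tm M) s (var (Suc n) v k) =
      Res (Tm M) (Comp (Cat M) (Pr M ?x ?A) s) (var n v k)"
    if "s \<in> hom (Cat M) w (ctx (Suc n) v)" "k < n" for s k
    using that Tm.Res_Comp[OF _ p vs, of s w k] by simp
  have "\<exists>!s. s \<in> hom (Cat M) w ?x \<and> (\<forall>k<n. Res (Tm M) s (var n v k) = a k)"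
    using Suc by simp
  then obtain b where b: "b \<in> hom (Cat M) w ?x" "\<forall>k<n. Res (Tm M) b (var n v k) = a k"
    and b_unique: "\<And>b'. b' \<in> hom (Cat M) w ?x \<Longrightarrow> \<forall>k<n. Res (Tm M) b' (var n v k) = a k \<Longrightarrow> b' = b"
    by blast
  \<comment> \<open>The pullback needs \<open>a n\<close> to have the type
    \<open>Res (Ty M) b ?A\<close>, which by stability is \<open>basic_ty w (v n)\<close>.\<close>
  have "\<exists>!s. s \<in> hom (Cat M) w (Ext M ?x ?A) \<and> Res (Tm M) s (Qv M ?x ?A) = a n \<and>
      Comp (Cat M) (Pr M ?x ?A) s = b"
    using Suc.prems Res_basic_ty[OF b(1)] by (intro ex1_to_Ext[OF o ty b(1)]) auto
  \<comment> \<open>Uniqueness of b turns agreement on the first n variables into an equation for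
    the composite with the projection.\<close>
  moreover have "s \<in> hom (Cat M) w (ctx (Suc n) v) \<and> (\<forall>k<Suc n. Res (Tm M) s (var (Suc n) v k) = a k)
      \<longleftrightarrow> s \<in> hom (Cat M) w (Ext M ?x ?A) \<and> Res (Tm M) s (Qv M ?x ?A) = a n \<and>
        Comp (Cat M) (Pr M ?x ?A) s = b" (is "?L s \<longleftrightarrow> ?R s") for s
  proof
    assume s: "?L s"
    have "Comp (Cat M) (Pr M ?x ?A) s = b"
      using s Res_var[of s] by (intro b_unique) (auto intro: C.Comp_hom[OF _ p] simp del: var.simps)
    with s show "?R s" by auto
  next
    assume s: "?R s"
    then have "Res (Tm M) s (var (Suc n) v k) = a k" if "k < Suc n" for k
      using that b(2) Res_var[of s k] by (cases "k = n") auto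
    with s show "?L s" by simp
  qed
  ultimately show ?case by simp
qed

section \<open>Substitutions induced by functions over I\<close>

definition sub :: "'i fin_arr \<Rightarrow> 'a" where
  "sub = (\<lambda>((n, u), f, (m, v)). THE s. s \<in> hom (Cat M) (ctx n u) (ctx m v) \<and>
    (\<forall>k<m. Res (Tm M) s (var m v k) = var n u (f k)))"

lemma fin_objs_range: "(n, u) \<in> fin_objs I \<Longrightarrow> k < n \<Longrightarrow> u k \<in> I"
  by (auto simp: fin_objs_def)

lemma fin_objs_ctx_Obj: "(n, u) \<in> fin_objs I \<Longrightarrow> ctx n u \<in> Obj (Cat M)"
  by (intro ctx_Obj fin_objs_range)

text \<open>The arrow runs against f: the k-th variable of the target context is replaced by the
  variable \<open>f k\<close> of the source context. Since f lies over I, this variable has the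
  basic type that \<open>ex1_to_ctx\<close> requires.\<close>

lemma ex1_sub:
  assumes "((n, u), f, (m, v)) \<in> fin_arrs I"
  shows "\<exists>!s. s \<in> hom (Cat M) (ctx n u) (ctx m v) \<and>
    (\<forall>k<m. Res (Tm M) s (var m v k) = var n u (f k))"
proof -
  have nu: "(n, u) \<in> fin_objs I" and mv: "(m, v) \<in> fin_objs I"
    and f: "\<And>k. k < m \<Longrightarrow> f k < n" "\<And>k. k < m \<Longrightarrow> u (f k) = v k"
    using assms by (auto simp: fin_arrs_def)
  show ?thesis
  proof (rule ex1_to_ctx)
    show "ctx n u \<in> Obj (Cat M)" by (rule fin_objs_ctx_Obj[OF nu])
    show "v k \<in> I" if "k < m" for k by (rule fin_objs_range[OF mv that])
    show "var n u (f k) \<in> Sec (Tm M) (ctx n u)" if "k < m" for k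
      by (rule var_Sec[OF fin_objs_range[OF nu] f(1)[OF that]])
    show "typ_of M (ctx n u) (var n u (f k)) = basic_ty (ctx n u) (v k)" if "k < m" for k
      using that typ_of_var[of n u "f k"] fin_objs_range[OF nu] f by simp
  qed
qed

lemma sub_hom:
  "((n, u), f, (m, v)) \<in> fin_arrs I \<Longrightarrow> sub ((n, u), f, (m, v)) \<in> hom (Cat M) (ctx n u) (ctx m v)"
  unfolding sub_def using theI'[OF ex1_sub] by fastforce

lemma Res_sub:
  "((n, u), f, (m, v)) \<in> fin_arrs I \<Longrightarrow> k < m \<Longrightarrow>
    Res (Tm M) (sub ((n, u), f, (m, v))) (var m v k) = var n u (f k)"
  unfolding sub_def using theI'[OF ex1_sub] by fastforce

text \<open>Arrows between these contexts are recognised by their effect on variables. This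
  identifies identities, projections and composites as values of \<open>sub\<close>, and later the
  image of an arrow under any competing morphism.\<close>

lemma sub_unique:
  assumes "((n, u), f, (m, v)) \<in> fin_arrs I" and "s \<in> hom (Cat M) (ctx n u) (ctx m v)"
    and "\<And>k. k < m \<Longrightarrow> Res (Tm M) s (var m v k) = var n u (f k)"
  shows "s = sub ((n, u), f, (m, v))"
  using ex1_sub[OF assms(1)] sub_hom[OF assms(1)] Res_sub[OF assms(1)] assms(2,3) by blast

section \<open>Existence of the morphism\<close>

definition interp :: "('i fin_obj, 'i fin_arr, 'i, nat, 'o, 'a, 'u, 'e) nm_map" where
  "interp = \<lparr>FOb = (\<lambda>x\<in>fin_objs I. ctx (fst x) (snd x)), FAr = (\<lambda>f\<in>fin_arrs I. sub f),
    FTy = (\<lambda>x\<in>fin_objs I. \<lambda>i\<in>I. basic_ty (ctx (fst x) (snd x)) i),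
    FTm = (\<lambda>x\<in>fin_objs I. \<lambda>k\<in>{..<fst x}. var (fst x) (snd x) k)\<rparr>"

lemma interp_simps:
  "(n, u) \<in> fin_objs I \<Longrightarrow> FOb interp (n, u) = ctx n u"
  "f \<in> fin_arrs I \<Longrightarrow> FAr interp f = sub f"
  "(n, u) \<in> fin_objs I \<Longrightarrow> i \<in> I \<Longrightarrow> FTy interp (n, u) i = basic_ty (ctx n u) i"
  "(n, u) \<in> fin_objs I \<Longrightarrow> k < n \<Longrightarrow> FTm interp (n, u) k = var n u k"
  by (simp_all add: interp_def)

lemma nm_morphism_interp: "nm_morphism (fin_model I) M interp"
proof -
  interpret fin: natural_model "fin_model I" by (rule natural_model_fin_model)
  interpret finC: category "fin_cat I" by (rule category_fin_cat)
  have arr: "F \<in> hom (fin_cat I) (n, u) (m, v) \<Longrightarrow>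
      \<exists>f. F = ((n, u), f, (m, v)) \<and> ((n, u), f, (m, v)) \<in> fin_arrs I \<and>
        (n, u) \<in> fin_objs I \<and> (m, v) \<in> fin_objs I \<and> (\<forall>k<m. f k < n)" for F n u m v
    by (auto simp: fin_hom_iff(2) fin_arrs_iff)
  have ext_cong: "ctx n (u(n := j)) = ctx n u" "var n (u(n := j)) k = var n u k" for n u j k
    by (auto intro: ctx_cong var_cong)
  show ?thesis
  proof
    show "FOb interp \<in> extensional (Obj (Cat (fin_model I)))"
      and "FAr interp \<in> extensional (Arr (Cat (fin_model I)))"
      and "FTy interp \<in> extensional (Obj (Cat (fin_model I)))"
      and "FTm interp \<in> extensional (Obj (Cat (fin_model I)))"
      by (simp_all add: interp_def fin_model_simps fin_cat_simps)
    show "FTy interp x \<in> extensional (Sec (Ty (fin_model I)) x)"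
      and "FTm interp x \<in> extensional (Sec (Tm (fin_model I)) x)"
      if "x \<in> Obj (Cat (fin_model I))" for x
      using that by (simp_all add: interp_def fin_model_simps fin_cat_simps)
  next
    fix x assume "x \<in> Obj (Cat (fin_model I))"
    moreover obtain n u where xnu: "x = (n, u)" by (cases x)
    ultimately have x: "(n, u) \<in> fin_objs I" by (simp add: fin_model_simps fin_cat_simps)
    note rng = fin_objs_range[OF x]
    have ob: "ctx n u \<in> Obj (Cat M)" by (rule fin_objs_ctx_Obj[OF x])
    show "FOb interp x \<in> Obj (Cat M)" using x ob by (simp add: xnu interp_simps)
    have "Ident (fin_cat I) (n, u) \<in> hom (fin_cat I) (n, u) (n, u)"
      using finC.Ident_hom[of "(n, u)"] x by (simp add: fin_cat_simps)
    then have id: "((n, u), (\<lambda>k\<in>{..<n}. k), (n, u)) \<in> fin_arrs I"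
      by (simp add: fin_cat_simps fin_hom_iff)
    have "Ident (Cat M) (ctx n u) = sub ((n, u), (\<lambda>k\<in>{..<n}. k), (n, u))"
      by (rule sub_unique[OF id C.Ident_hom[OF ob]]) (simp add: Tm.Res_Ident[OF ob] var_Sec rng)
    then show "FAr interp (Ident (Cat (fin_model I)) x) = Ident (Cat M) (FOb interp x)"
      using x id by (simp add: xnu interp_simps fin_model_simps fin_cat_simps)
    show "FTm interp x k \<in> Sec (Tm M) (FOb interp x)"
      and "typ_of M (FOb interp x) (FTm interp x k) = FTy interp x (typ_of (fin_model I) x k)"
      if "k \<in> Sec (Tm (fin_model I)) x" for k
      using that x by (simp_all add: xnu fin_model_simps interp_simps var_Sec typ_of_var rng)
    fix j assume "j \<in> Sec (Ty (fin_model I)) x"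
    then have j: "j \<in> I" by (simp add: fin_model_simps)
    have ty: "basic_ty (ctx n u) j \<in> Sec (Ty M) (ctx n u)" by (rule basic_ty_Sec[OF ob j])
    show "FTy interp x j \<in> Sec (Ty M) (FOb interp x)" using x j ty by (simp add: xnu interp_simps)
    have e: "(Suc n, u(n := j)) \<in> fin_objs I"
      using x j by (auto simp: fin_objs_def PiE_iff extensional_def)
    then show "FOb interp (Ext (fin_model I) x j) = Ext M (FOb interp x) (FTy interp x j)"
      and "FTm interp (Ext (fin_model I) x j) (Qv (fin_model I) x j) =
        Qv M (FOb interp x) (FTy interp x j)"
      using x j by (simp_all add: xnu fin_model_simps interp_simps ext_cong)
    have p: "((Suc n, u(n := j)), (\<lambda>k\<in>{..<n}. k), (n, u)) \<in> fin_arrs I"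
      using x e by (auto simp: fin_arrs_def)
    \<comment> \<open>By the recursion for \<open>var\<close>, restricting an old variable along the
      projection gives the variable with the same number in the longer context.\<close>
    have "Pr M (ctx n u) (basic_ty (ctx n u) j) =
        sub ((Suc n, u(n := j)), (\<lambda>k\<in>{..<n}. k), (n, u))"
      by (rule sub_unique[OF p]) (simp_all add: ext_cong Pr[OF ob ty])
    then show "FAr interp (Pr (fin_model I) x j) = Pr M (FOb interp x) (FTy interp x j)"
      using x j p by (simp add: xnu fin_model_simps interp_simps)
  next
    fix F and x y :: "'i fin_obj" assume "F \<in> hom (Cat (fin_model I)) x y"
    moreover obtain n u m v where xy: "x = (n, u)" "y = (m, v)" by (cases x; cases y)
    ultimately obtain f where F: "F = ((n, u), f, (m, v))" "((n, u), f, (m, v)) \<in> fin_arrs I"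
        "(n, u) \<in> fin_objs I" "(m, v) \<in> fin_objs I" "\<forall>k<m. f k < n"
      using arr[of F n u m v] unfolding fin_model_simps(1) by blast
    show "FAr interp F \<in> hom (Cat M) (FOb interp x) (FOb interp y)"
      using F sub_hom[OF F(2)] by (simp add: xy interp_simps)
    show "FTy interp x (Res (Ty (fin_model I)) F i) = Res (Ty M) (FAr interp F) (FTy interp y i)"
      if "i \<in> Sec (Ty (fin_model I)) y" for i
      using that F Res_basic_ty[OF sub_hom[OF F(2)]] by (simp add: xy fin_model_simps interp_simps)
    show "FTm interp x (Res (Tm (fin_model I)) F k) = Res (Tm M) (FAr interp F) (FTm interp y k)"
      if "k \<in> Sec (Tm (fin_model I)) y" for k
      using that F Res_sub[OF F(2)] by (simp add: xy fin_model_simps interp_simps)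
    fix G and z :: "'i fin_obj" assume G': "G \<in> hom (Cat (fin_model I)) y z"
    moreover obtain l w where z: "z = (l, w)" by (cases z)
    ultimately obtain g where G: "G = ((m, v), g, (l, w))" "((m, v), g, (l, w)) \<in> fin_arrs I"
        "(l, w) \<in> fin_objs I" "\<forall>k<l. g k < m"
      using arr[of G m v l w] xy unfolding fin_model_simps(1) by blast
    \<comment> \<open>In the opposite category the composite of F followed by G is the function f
      after g, restricted so as to be extensional.\<close>
    let ?h = "((n, u), (\<lambda>k\<in>{..<l}. f (g k)), (l, w))"
    have "Comp (fin_cat I) G F \<in> hom (fin_cat I) (n, u) (l, w)"
      using F G by (intro finC.Comp_hom[of F _ "(m, v)"]) (simp_all add: fin_hom_iff)
    then have GF: "Comp (fin_cat I) G F = ?h" "?h \<in> fin_arrs I"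
      by (simp_all add: F(1) G(1) fin_cat_simps fin_hom_iff)
    have "Comp (Cat M) (sub G) (sub F) = sub ?h"
    proof (rule sub_unique[OF GF(2)])
      show "Comp (Cat M) (sub G) (sub F) \<in> hom (Cat M) (ctx n u) (ctx l w)"
        using C.Comp_hom[OF sub_hom[OF F(2)] sub_hom[OF G(2)]] by (simp add: F(1) G(1))
      show "Res (Tm M) (Comp (Cat M) (sub G) (sub F)) (var l w k) =
          var n u ((\<lambda>k\<in>{..<l}. f (g k)) k)" if "k < l" for k
        using that Tm.Res_Comp[OF sub_hom[OF F(2)] sub_hom[OF G(2)] var_Sec[of l w k]]
          fin_objs_range[OF G(3)] Res_sub[OF G(2), of k] Res_sub[OF F(2), of "g k"] G(4)
        by (simp add: F(1) G(1))
    qed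
    then show "FAr interp (Comp (Cat (fin_model I)) G F) = Comp (Cat M) (FAr interp G) (FAr interp F)"
      using F(2) G(2) GF by (simp add: fin_model_simps interp_simps F(1) G(1))
  next
    show "FOb interp (Term (fin_model I)) = Term M"
      by (simp add: fin_model_simps interp_def fin_objs_def)
  qed
qed

lemma interp_Term: "i \<in> I \<Longrightarrow> FTy interp (Term (fin_model I)) i = Os i"
  by (simp add: fin_model_simps interp_def fin_objs_def basic_ty_Term)

section \<open>Uniqueness of the morphism\<close>

lemma eq_interp:
  assumes F: "nm_morphism (fin_model I) M F"
    and F_Os: "\<forall>i\<in>I. FTy F (Term (fin_model I)) i = Os i"
  shows "F = interp"
proof -
  interpret F: nm_morphism "fin_model I" M F by (rule F)
  \<comment> \<open>In the constant presheaf, i over x is the restriction of i along the arrow f to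
    the terminal object; F preserves both that object and restriction.\<close>
  have F_ty: "FTy F x i = basic_ty (FOb F x) i" if "x \<in> fin_objs I" "i \<in> I" for x i
  proof -
    have "x \<in> Obj (Cat (fin_model I))" using that by (simp add: fin_model_simps fin_cat_simps)
    then obtain f where f: "f \<in> hom (Cat (fin_model I)) x (Term (fin_model I))"
      using F.M.Term unfolding terminal_object_def by blast
    have "FAr F f = bang (FOb F x)" using F.FAr[OF f] by (simp add: F.F_Term bang_unique)
    then show ?thesis
      using F.FTy_Res[OF f, of i] F_Os that(2) by (simp add: basic_ty_def fin_model_simps)
  qed
  \<comment> \<open>Every object arises from the empty one by appending basic types, so strict
    preservation of \<open>Ext\<close>, \<open>Pr\<close> and \<open>Qv\<close> fixes the images of
    objects and variables.\<close>
  have F_ob_tm: "FOb F (n, u) = ctx n u \<and> (\<forall>k<n. FTm F (n, u) k = var n u k)"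
    if "(n, u) \<in> fin_objs I" for n u
    using that
  proof (induction n arbitrary: u)
    case 0
    \<comment> \<open>Extensionality leaves a single function on the empty set, so this is the
      distinguished terminal object.\<close>
    then have "u = (\<lambda>_. undefined)" by (simp add: fin_objs_def)
    then show ?case using F.F_Term by (simp add: fin_model_simps)
  next
    case (Suc n)
    \<comment> \<open>Cutting u down to its first n entries gives the object whose extension by
      \<open>u n\<close> is \<open>(Suc n, u)\<close> on the nose.\<close>
    define v where "v = restrict u {..<n}"
    have u: "u \<in> {..<Suc n} \<rightarrow>\<^sub>E I" using Suc.prems by (simp add: fin_objs_def)
    have un: "u n \<in> I" by (rule PiE_mem[OF u]) simp
    have x: "(n, v) \<in> fin_objs I"
      unfolding fin_objs_def v_def using PiE_mem[OF u] by (simp add: restrict_PiE_iff)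
    have uu: "v(n := u n) = u"
    proof
      fix k
      show "(v(n := u n)) k = u k"
        using PiE_arb[OF u, of k] by (cases "k < n"; cases "k = n") (auto simp: v_def)
    qed
    have cong: "ctx n v = ctx n u" "var n v k = var n u k" for k
      by (auto simp: v_def intro: ctx_cong var_cong)
    have x': "(n, v) \<in> Obj (Cat (fin_model I))" and un': "u n \<in> Sec (Ty (fin_model I)) (n, v)"
      using x un by (simp_all add: fin_model_simps fin_cat_simps)
    have E: "Ext (fin_model I) (n, v) (u n) = (Suc n, u)" using uu by (simp add: fin_model_simps)
    have ob: "FOb F (n, v) = ctx n u" and tm: "\<And>k. k < n \<Longrightarrow> FTm F (n, v) k = var n u k"
      using Suc.IH[OF x] cong by auto
    have ty: "FTy F (n, v) (u n) = basic_ty (ctx n u) (u n)" using F_ty[OF x un] ob by simp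
    have "FOb F (Suc n, u) = ctx (Suc n) u" using F.F_Ext[OF x' un'] by (simp add: E ob ty)
    moreover have "FTm F (Suc n, u) k = var (Suc n) u k" if "k < Suc n" for k
    proof (cases "k = n")
      case True
      then show ?thesis using F.F_Qv[OF x' un'] unfolding E by (simp add: ob ty fin_model_simps)
    next
      case False
      have p: "Pr (fin_model I) (n, v) (u n) \<in> hom (Cat (fin_model I)) (Suc n, u) (n, v)"
        using F.M.Pr[OF x' un'] unfolding E .
      \<comment> \<open>Naturality along the projection, which in \<open>fin_model I\<close> is an
        inclusion: restricting k along it gives k again.\<close>
      have "FTm F (Suc n, u) (Res (Tm (fin_model I)) (Pr (fin_model I) (n, v) (u n)) k) =
          Res (Tm M) (Pr M (ctx n u) (basic_ty (ctx n u) (u n))) (var n u k)"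
        using F.FTm_Res[OF p, of k] F.F_Pr[OF x' un'] tm[of k] that False
        by (simp add: ob ty fin_model_simps)
      then show ?thesis using that False by (simp add: fin_model_simps)
    qed
    ultimately show ?case by blast
  qed
  show ?thesis
  proof (rule nm_map_eqI[OF F nm_morphism_interp])
    fix x assume "x \<in> Obj (Cat (fin_model I))"
    moreover obtain n u where xnu: "x = (n, u)" by (cases x)
    ultimately have x: "(n, u) \<in> fin_objs I" by (simp add: fin_model_simps fin_cat_simps)
    show "FOb F x = FOb interp x" using F_ob_tm[OF x] x by (simp add: xnu interp_simps)
    show "FTy F x i = FTy interp x i" if "i \<in> Sec (Ty (fin_model I)) x" for i
      using that F_ty[OF x] F_ob_tm[OF x] x by (simp add: xnu interp_simps fin_model_simps)
    show "FTm F x k = FTm interp x k" if "k \<in> Sec (Tm (fin_model I)) x" for k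
      using that F_ob_tm[OF x] x by (simp add: xnu interp_simps fin_model_simps)
  next
    fix f assume "f \<in> Arr (Cat (fin_model I))"
    moreover obtain n u g m v where f: "f = ((n, u), g, (m, v))" by (metis surj_pair)
    ultimately have arr: "((n, u), g, (m, v)) \<in> fin_arrs I"
      by (simp add: fin_model_simps fin_cat_simps)
    then have x: "(n, u) \<in> fin_objs I" and y: "(m, v) \<in> fin_objs I" and g: "\<And>k. k < m \<Longrightarrow> g k < n"
      by (auto simp: fin_arrs_def)
    have h: "f \<in> hom (Cat (fin_model I)) (n, u) (m, v)"
      using arr by (simp add: f fin_model_simps fin_hom_iff)
    \<comment> \<open>Naturality of F on terms makes \<open>FAr F f\<close> act on variables as g
      does, and this action determines an arrow into a context.\<close>
    have "FAr F f = sub ((n, u), g, (m, v))"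
    proof (rule sub_unique[OF arr])
      show "FAr F f \<in> hom (Cat M) (ctx n u) (ctx m v)"
        using F.FAr[OF h] F_ob_tm[OF x] F_ob_tm[OF y] by simp
      show "Res (Tm M) (FAr F f) (var m v k) = var n u (g k)" if "k < m" for k
        using F.FTm_Res[OF h, of k] F_ob_tm[OF x] F_ob_tm[OF y] g that by (simp add: f fin_model_simps)
    qed
    then show "FAr F f = FAr interp f" using arr by (simp add: f interp_simps)
  qed
qed

lemma ex1_morphism_from_fin_model:
  "\<exists>!F. nm_morphism (fin_model I) M F \<and> (\<forall>i\<in>I. FTy F (Term (fin_model I)) i = Os i)"
  using nm_morphism_interp interp_Term eq_interp by blast

end

theorem theorem4p1p5:
  fixes I :: "'i set"
  shows
    "(\<forall>(M :: ('o, 'a, 'u, 'e) nm_data) Os.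
        natural_model M \<longrightarrow> Os \<in> I \<rightarrow> Sec (Ty M) (Term M) \<longrightarrow>
        (\<exists>!F. nm_morphism (fin_model I) M F \<and>
          (\<forall>i\<in>I. FTy F (Term (fin_model I)) i = Os i)))
    \<and> nmty_object I (fin_model I) (\<lambda>i. i)
    \<and> (\<forall>(N :: ('o, 'a, 'u, 'e) nm_data) Ps.
        nmty_object I N Ps \<longrightarrow> (\<exists>!F. nmty_morphism I (fin_model I) (\<lambda>i. i) N Ps F))"
proof (intro conjI allI impI)
  show ex1: "\<exists>!F. nm_morphism (fin_model I) M F \<and> (\<forall>i\<in>I. FTy F (Term (fin_model I)) i = Os i)"
    if "natural_model M" "Os \<in> I \<rightarrow> Sec (Ty M) (Term M)"
    for M :: "('o, 'a, 'u, 'e) nm_data" and Os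
    using that
    by (intro model_with_types.ex1_morphism_from_fin_model model_with_types.intro
        model_with_types_axioms.intro)
  show fin: "nmty_object I (fin_model I) (\<lambda>i. i)" by (rule nmty_object_fin_model)
  \<comment> \<open>The basic types of \<open>fin_model I\<close> are the indices themselves, so
    preserving the families is the condition of the first claim.\<close>
  show "\<exists>!F. nmty_morphism I (fin_model I) (\<lambda>i. i) N Ps F" if "nmty_object I N Ps"
    for N :: "('o, 'a, 'u, 'e) nm_data" and Ps
    using that fin ex1[of N Ps] by (simp add: nmty_morphism_def nmty_object_def)
qed

end
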